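(* Any one-pass streaming algorithm for the $k$-Dominating Set problem on $n$-vertex graphs requires $\Omega(n^2)$ bits of space, even when $k=3$.
   Context: $k$-Dominating Set: given an undirected graph $G=(V,E)$, decide whether there is a set $S\subseteq V$ with $|S|\le k$ such that every vertex of $V\setminus S$ has at least one neighbor in $S$. Streaming model: the vertex set is fixed and the edges arrive one by one (the lower bound holds already for insertion-only streams). Lower bounds apply to all algorithms, including randomized ones that answer correctly with constant probability (say at least $2/3$). *)

theory Defs
  imports "HOL-Probability.Probability_Mass_Function" "HOL-Library.Landau_Symbols"
begin

definition dominating_set :: "'a set \<Rightarrow> 'a set set \<Rightarrow> 'a set \<Rightarrow> bool" where
  "dominating_set V E S \<longleftrightarrow> S \<subseteq> V \<and> (\<forall>v \<in> V - S. \<exists>u \<in> S. {u, v} \<in> E)"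

definition has_k_dominating_set :: "nat \<Rightarrow> 'a set \<Rightarrow> 'a set set \<Rightarrow> bool" where
  "has_k_dominating_set k V E \<longleftrightarrow> (\<exists>S. finite S \<and> card S \<le> k \<and> dominating_set V E S)"

text \<open>Insertion-only streams: the edges of a simple undirected graph on the vertex set
  \<open>{..<n}\<close>, each edge arriving exactly once, in arbitrary order.\<close>

definition edge_stream :: "nat \<Rightarrow> nat set list \<Rightarrow> bool" where
  "edge_stream n es \<longleftrightarrow> distinct es \<and> (\<forall>e \<in> set es. e \<subseteq> {..<n} \<and> card e = 2)"

text \<open>A randomized one-pass algorithm whose working memory is a bit string. Both usual sources of
  randomness are available: a random seed, which may be read at any time and is not charged as
  memory, and fresh coins in every step. Deterministic algorithms are the case where all
  distributions are point masses. Only the memory content between two arrivals is charged.\<close>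

record 'r streaming_alg =
  seed_dist :: "'r pmf"
  initial_mem :: "'r \<Rightarrow> bool list pmf"
  process_edge :: "'r \<Rightarrow> nat set \<Rightarrow> bool list \<Rightarrow> bool list pmf"
  final_answer :: "'r \<Rightarrow> bool list \<Rightarrow> bool pmf"

definition mem_after :: "'r streaming_alg \<Rightarrow> 'r \<Rightarrow> nat set list \<Rightarrow> bool list pmf" where
  "mem_after A r es = foldl (\<lambda>M e. bind_pmf M (process_edge A r e)) (initial_mem A r) es"

definition answer_on :: "'r streaming_alg \<Rightarrow> nat set list \<Rightarrow> bool pmf" where
  "answer_on A es =
     bind_pmf (seed_dist A) (\<lambda>r. bind_pmf (mem_after A r es) (final_answer A r))"

definition solves_dominating_set :: "nat \<Rightarrow> nat \<Rightarrow> 'r streaming_alg \<Rightarrow> bool" where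
  "solves_dominating_set k n A \<longleftrightarrow>
     (\<forall>es. edge_stream n es \<longrightarrow>
        pmf (answer_on A es) (has_k_dominating_set k {..<n} (set es)) \<ge> 2 / 3)"

text \<open>Every prefix of an edge stream is an edge stream, so this bounds the memory at all times.\<close>

definition uses_space :: "nat \<Rightarrow> 'r streaming_alg \<Rightarrow> nat \<Rightarrow> bool" where
  "uses_space n A s \<longleftrightarrow>
     (\<forall>es. edge_stream n es \<longrightarrow>
        (\<forall>r \<in> set_pmf (seed_dist A). \<forall>m \<in> set_pmf (mem_after A r es). length m \<le> s))"

end

theory Submission imports Defs begin

text \<open>The memory left by a prefix of the stream is a one-way message: with the seed, it is all
  that the rest of the run knows about the prefix. A prefix can store any
  \<open>x \<subseteq> {..<l} \<times> {..<l}\<close> as a bipartite graph, and a suffix chosen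
  without knowing \<open>x\<close> turns membership of one pair in \<open>x\<close> into the
  domination question (\<open>has_k_dominating_set_reduction\<close>). So the algorithm solves INDEX
  on l^2 bits, where l is linear in n.

  INDEX needs messages of linear length (\<open>index_lower_bound\<close>). For a fixed message and
  uniform \<open>x\<close>, the advantage over blind guessing is a sum of independent signs with
  bounded weights, with small exponential moment (\<open>sum_Pow_exp_le\<close>). Letting the
  message depend on \<open>x\<close> adds only a multiple of \<open>ln (card M)\<close> to the
  expected advantage, and success 2/3 needs a linear advantage.\<close>

section \<open>Exponential moments of random signed sums\<close>

lemma exp_add_exp_minus_le:
  fixes t :: real
  assumes "\<bar>t\<bar> \<le> 1"
  shows "exp t + exp (- t) \<le> 2 * exp (t\<^sup>2)"
proof -
  have "exp u + exp (- u) \<le> 2 * exp (u\<^sup>2)" if u: "0 \<le> u" "u \<le> 1" for u :: real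
  proof -
    have 1: "exp u \<le> 1 + u + u\<^sup>2"
      using exp_bound u by auto
    \<comment> \<open>The product equals 1 + u^3.\<close>
    have "1 \<le> (1 - u + u\<^sup>2) * (1 + u)"
      using u by (simp add: algebra_simps power2_eq_square)
    also have "\<dots> \<le> (1 - u + u\<^sup>2) * exp u"
    proof (rule mult_left_mono)
      show "0 \<le> 1 - u + u\<^sup>2"
        using u zero_le_power2[of u] by linarith
    qed (rule exp_ge_add_one_self)
    finally have 2: "exp (- u) \<le> 1 - u + u\<^sup>2"
      by (simp add: exp_minus field_simps)
    show ?thesis
      using 1 2 exp_ge_add_one_self[of "u\<^sup>2"] by linarith
  qed
  from this[of "\<bar>t\<bar>"] assms show ?thesis
    by (cases "t \<ge> 0") (auto simp: add.commute)
qed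

text \<open>A uniformly random subset gives independent signs, so the moment generating function
  factorises: expanding a product of binomials over \<open>I\<close> yields exactly one term per
  subset.\<close>

lemma sum_Pow_exp_le:
  fixes a :: "'i \<Rightarrow> real"
  assumes "finite I" and a: "\<And>i. i \<in> I \<Longrightarrow> \<bar>a i\<bar> \<le> B" and "B \<le> 1"
  shows "(\<Sum>x\<in>Pow I. exp (\<Sum>i\<in>I. if i \<in> x then a i else - a i))
           \<le> 2 ^ card I * exp (B\<^sup>2 * card I)"
proof -
  have "(\<Sum>x\<in>Pow I. exp (\<Sum>i\<in>I. if i \<in> x then a i else - a i))
      = (\<Sum>x\<in>Pow I. (\<Prod>i\<in>x. exp (a i)) * (\<Prod>i\<in>I - x. exp (- a i)))"
  proof (intro sum.cong refl)
    fix x assume x: "x \<in> Pow I"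
    have "exp (\<Sum>i\<in>I. if i \<in> x then a i else - a i)
        = (\<Prod>i\<in>I. if i \<in> x then exp (a i) else exp (- a i))"
      using \<open>finite I\<close> by (subst exp_sum) (auto intro!: prod.cong)
    also have "\<dots> = (\<Prod>i\<in>x. exp (a i)) * (\<Prod>i\<in>I - x. exp (- a i))"
    proof -
      have eq: "I \<inter> {i. i \<in> x} = x" "I \<inter> - {i. i \<in> x} = I - x"
        using x by auto
      show ?thesis
        unfolding prod.If_cases[OF \<open>finite I\<close>] eq ..
    qed
    finally show "exp (\<Sum>i\<in>I. if i \<in> x then a i else - a i)
        = (\<Prod>i\<in>x. exp (a i)) * (\<Prod>i\<in>I - x. exp (- a i))" .
  qed
  also have "\<dots> = (\<Prod>i\<in>I. exp (a i) + exp (- a i))"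
    using \<open>finite I\<close> by (simp add: prod_add)
  also have "\<dots> \<le> (\<Prod>i\<in>I. 2 * exp (B\<^sup>2))"
  proof (intro prod_mono conjI)
    fix i assume i: "i \<in> I"
    have "exp (a i) + exp (- a i) \<le> 2 * exp ((a i)\<^sup>2)"
      using a[OF i] \<open>B \<le> 1\<close> by (intro exp_add_exp_minus_le) linarith
    also have "(a i)\<^sup>2 \<le> B\<^sup>2"
      using a[OF i] abs_le_square_iff[of "a i" B] by linarith
    finally show "exp (a i) + exp (- a i) \<le> 2 * exp (B\<^sup>2)"
      by simp
    show "0 \<le> exp (a i) + exp (- a i)"
      by (intro add_nonneg_nonneg) auto
  qed
  also have "\<dots> = 2 ^ card I * exp (B\<^sup>2 * card I)"
    by (simp add: power_mult_distrib exp_of_nat2_mult)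
  finally show ?thesis .
qed

section \<open>The one-way communication bound for INDEX\<close>

lemma pmf_bool_if:
  "pmf p b = 1 / 2 + (if b then pmf p True - 1 / 2 else - (pmf p True - 1 / 2))"
  by (cases b) (auto simp: pmf_False_conv_True)

lemma integrable_pmf_bounded:
  fixes f :: "'a \<Rightarrow> real"
  assumes "\<And>x. 0 \<le> f x" "\<And>x. f x \<le> B"
  shows "integrable (measure_pmf p) f"
  using assms by (intro measure_pmf.integrable_const_bound[where B = B]) auto

text \<open>Here \<open>dec m i\<close> has to guess whether \<open>i\<close> belongs to the random set \<open>x\<close> from a message
  distributed as \<open>enc x\<close>. For a fixed message the advantage over blind guessing is a sum of
  independent centred variables. Bounding it by a tangent line of the exponential makes the
  estimate linear, so that the message distribution may be replaced by the sum over all messages.\<close>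

lemma index_success_bound:
  fixes enc :: "'i set \<Rightarrow> 'm pmf" and dec :: "'m \<Rightarrow> 'i \<Rightarrow> bool pmf"
  assumes I: "finite I" and M: "finite M" "M \<noteq> {}"
    and enc: "\<And>x. x \<subseteq> I \<Longrightarrow> set_pmf (enc x) \<subseteq> M"
  shows "(\<Sum>x\<in>Pow I. \<Sum>i\<in>I. pmf (bind_pmf (enc x) (\<lambda>m. dec m i)) (i \<in> x))
           \<le> 2 ^ card I * (card I / 2 + 3 * ln (card M) + card I / 12)"
proof -
  define N where "N = real (card I)"
  \<comment> \<open>With scale t in place of 1/3 the final bound is t * (1/6 - t/4) per index: 1/6
    is the required advantage and t/4 the moment loss. It is maximal at t = 1/3, with value
    1/36.\<close>
  define a where "a m i = (pmf (dec m i) True - 1 / 2) / 3" for m i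
  define Z where "Z m x = (\<Sum>i\<in>I. if i \<in> x then a m i else - a m i)" for m x
  \<comment> \<open>Chosen so that \<open>exp (- c)\<close> cancels both the number of messages and
    the moment factor in \<open>moment\<close>.\<close>
  define c where "c = ln (card M) + N / 36"
  have cardM: "real (card M) > 0"
    using M by (simp add: card_gt_0_iff)
  have success: "(\<Sum>i\<in>I. pmf (bind_pmf (enc x) (\<lambda>m. dec m i)) (i \<in> x))
      = (\<Sum>m\<in>M. pmf (enc x) m * (N / 2 + 3 * Z m x))" if x: "x \<subseteq> I" for x
  proof -
    have "(\<Sum>i\<in>I. pmf (bind_pmf (enc x) (\<lambda>m. dec m i)) (i \<in> x))
        = (\<Sum>i\<in>I. \<Sum>m\<in>M. pmf (enc x) m * pmf (dec m i) (i \<in> x))"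
      unfolding pmf_bind
      by (intro sum.cong refl, subst integral_measure_pmf[OF M(1)]) (use enc[OF x] in auto)
    also have "\<dots> = (\<Sum>m\<in>M. pmf (enc x) m * (\<Sum>i\<in>I. pmf (dec m i) (i \<in> x)))"
      by (subst sum.swap) (simp add: sum_distrib_left)
    also have "\<dots> = (\<Sum>m\<in>M. pmf (enc x) m * (N / 2 + 3 * Z m x))"
    proof (intro sum.cong refl arg_cong2[where f = "(*)"])
      fix m
      have "pmf (dec m i) (i \<in> x) = 1 / 2 + 3 * (if i \<in> x then a m i else - a m i)" for i
        by (subst pmf_bool_if) (simp add: a_def field_simps)
      then show "(\<Sum>i\<in>I. pmf (dec m i) (i \<in> x)) = N / 2 + 3 * Z m x"
        by (simp add: sum.distrib Z_def N_def sum_distrib_left)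
    qed
    finally show ?thesis .
  qed
  have mass: "(\<Sum>m\<in>M. pmf (enc x) m) = 1" if "x \<subseteq> I" for x
    using sum_pmf_eq_1[OF M(1) enc[OF that]] .
  have tangent: "(\<Sum>m\<in>M. pmf (enc x) m * (N / 2 + 3 * Z m x))
      \<le> N / 2 + 3 * (c - 1) + 3 * (\<Sum>m\<in>M. exp (Z m x) * exp (- c))" if x: "x \<subseteq> I" for x
  proof -
    have "(\<Sum>m\<in>M. pmf (enc x) m * (N / 2 + 3 * Z m x))
        \<le> (\<Sum>m\<in>M. pmf (enc x) m * (N / 2 + 3 * (c - 1)) + 3 * (exp (Z m x) * exp (- c)))"
    proof (rule sum_mono)
      fix m
      have "Z m x \<le> c - 1 + exp (Z m x) * exp (- c)"
        using exp_ge_add_one_self[of "Z m x - c"] by (simp add: exp_diff exp_minus field_simps)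
      then have "pmf (enc x) m * (N / 2 + 3 * Z m x)
          \<le> pmf (enc x) m * (N / 2 + 3 * (c - 1) + 3 * (exp (Z m x) * exp (- c)))"
        by (intro mult_left_mono) (simp_all add: algebra_simps)
      also have "\<dots> = pmf (enc x) m * (N / 2 + 3 * (c - 1))
          + pmf (enc x) m * (3 * (exp (Z m x) * exp (- c)))"
        by (rule distrib_left)
      also have "pmf (enc x) m * (3 * (exp (Z m x) * exp (- c))) \<le> 3 * (exp (Z m x) * exp (- c))"
        by (intro mult_left_le_one_le) (auto simp: pmf_le_1)
      finally show "pmf (enc x) m * (N / 2 + 3 * Z m x)
          \<le> pmf (enc x) m * (N / 2 + 3 * (c - 1)) + 3 * (exp (Z m x) * exp (- c))"
        by simp
    qed
    also have "\<dots> = N / 2 + 3 * (c - 1) + 3 * (\<Sum>m\<in>M. exp (Z m x) * exp (- c))"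
      by (simp add: sum.distrib sum_distrib_left[symmetric] sum_distrib_right[symmetric] mass[OF x])
    finally show ?thesis .
  qed
  have "(\<Sum>x\<in>Pow I. \<Sum>m\<in>M. exp (Z m x) * exp (- c))
      = (\<Sum>m\<in>M. (\<Sum>x\<in>Pow I. exp (Z m x)) * exp (- c))"
    by (subst sum.swap) (simp add: sum_distrib_right)
  also have "\<dots> \<le> (\<Sum>m\<in>M. (2 ^ card I * exp ((1 / 6)\<^sup>2 * card I)) * exp (- c))"
  proof (intro sum_mono mult_right_mono)
    fix m
    have "\<bar>a m i\<bar> \<le> 1 / 6" for i
      using pmf_nonneg[of "dec m i" True] pmf_le_1[of "dec m i" True]
      unfolding a_def abs_le_iff by auto
    then show "(\<Sum>x\<in>Pow I. exp (Z m x)) \<le> 2 ^ card I * exp ((1 / 6)\<^sup>2 * card I)"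
      unfolding Z_def by (intro sum_Pow_exp_le I) auto
  qed auto
  also have "\<dots> = 2 ^ card I"
  proof -
    have "exp c = card M * exp ((1 / 6)\<^sup>2 * card I)"
      using cardM by (simp add: c_def N_def exp_add power2_eq_square)
    then have "card M * exp ((1 / 6)\<^sup>2 * card I) * exp (- c) = 1"
      by (metis exp_minus_inverse)
    then show ?thesis
      by (simp add: mult_ac)
  qed
  finally have moment: "(\<Sum>x\<in>Pow I. \<Sum>m\<in>M. exp (Z m x) * exp (- c)) \<le> 2 ^ card I" .
  have "(\<Sum>x\<in>Pow I. \<Sum>i\<in>I. pmf (bind_pmf (enc x) (\<lambda>m. dec m i)) (i \<in> x))
      \<le> (\<Sum>x\<in>Pow I. N / 2 + 3 * (c - 1) + 3 * (\<Sum>m\<in>M. exp (Z m x) * exp (- c)))"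
    using success tangent by (intro sum_mono) auto
  also have "\<dots> = 2 ^ card I * (N / 2 + 3 * (c - 1))
      + 3 * (\<Sum>x\<in>Pow I. \<Sum>m\<in>M. exp (Z m x) * exp (- c))"
    using I by (simp add: sum.distrib sum_distrib_left[symmetric] card_Pow)
  also have "\<dots> \<le> 2 ^ card I * (N / 2 + 3 * (c - 1)) + 3 * 2 ^ card I"
    using moment by simp
  also have "\<dots> = 2 ^ card I * (card I / 2 + 3 * ln (card M) + card I / 12)"
    by (simp add: c_def N_def algebra_simps)
  finally show ?thesis .
qed

text \<open>For each seed the total success over all sets and indices obeys the previous bound,
  hence so does its average over seeds: shared randomness does not help.\<close>

theorem index_lower_bound:
  fixes seed :: "'r pmf" and enc :: "'r \<Rightarrow> 'i set \<Rightarrow> 'm pmf"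
    and dec :: "'r \<Rightarrow> 'm \<Rightarrow> 'i \<Rightarrow> bool pmf"
  assumes I: "finite I" and M: "finite M" "M \<noteq> {}"
    and enc: "\<And>r x. r \<in> set_pmf seed \<Longrightarrow> x \<subseteq> I \<Longrightarrow> set_pmf (enc r x) \<subseteq> M"
    and correct: "\<And>x i. x \<subseteq> I \<Longrightarrow> i \<in> I \<Longrightarrow>
      pmf (bind_pmf seed (\<lambda>r. bind_pmf (enc r x) (\<lambda>m. dec r m i))) (i \<in> x) \<ge> 2 / 3"
  shows "card I / 36 \<le> ln (card M)"
proof -
  define g where "g r x i = pmf (bind_pmf (enc r x) (\<lambda>m. dec r m i)) (i \<in> x)" for r x i
  have int: "integrable (measure_pmf seed) (\<lambda>r. g r x i)" for x i
    by (rule integrable_pmf_bounded[where B = 1]) (auto simp: g_def pmf_le_1)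
  have "2 ^ card I * (card I * (2 / 3)) = (\<Sum>x\<in>Pow I. \<Sum>i\<in>I. 2 / 3 :: real)"
    using I by (simp add: card_Pow)
  also have "\<dots> \<le> (\<Sum>x\<in>Pow I. \<Sum>i\<in>I. \<integral>r. g r x i \<partial>measure_pmf seed)"
    using correct by (intro sum_mono) (auto simp: g_def pmf_bind)
  also have "\<dots> = (\<integral>r. (\<Sum>x\<in>Pow I. \<Sum>i\<in>I. g r x i) \<partial>measure_pmf seed)"
    using int by (simp add: Bochner_Integration.integral_sum)
  also have "\<dots> \<le> 2 ^ card I * (card I / 2 + 3 * ln (card M) + card I / 12)"
  proof (rule measure_pmf.integral_le_const)
    show "AE r in measure_pmf seed.
        (\<Sum>x\<in>Pow I. \<Sum>i\<in>I. g r x i) \<le> 2 ^ card I * (card I / 2 + 3 * ln (card M) + card I / 12)"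
      unfolding g_def using index_success_bound[OF I M enc] by (auto simp: AE_measure_pmf_iff)
  qed (use int in auto)
  finally have "card I * (2 / 3) \<le> card I / 2 + 3 * ln (card M) + card I / 12"
    by (simp only: mult_le_cancel_left_pos zero_less_power zero_less_numeral)
  then show ?thesis
    by simp
qed

section \<open>Streaming memory as a message, and INDEX as a domination question\<close>

lemma card_bool_lists_length_le: "card {m :: bool list. length m \<le> s} \<le> 2 ^ (s + 1)"
proof -
  have "card {m :: bool list. length m \<le> s} = (\<Sum>i\<le>s. 2 ^ i)"
    using card_lists_length_le[of "UNIV :: bool set" s] by simp
  also have "\<dots> \<le> 2 ^ (s + 1)"
    by (induction s) auto
  finally show ?thesis .
qed

lemma foldl_bind_pmf:
  "foldl (\<lambda>M e. bind_pmf M (f e)) (bind_pmf M g) es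
     = bind_pmf M (\<lambda>m. foldl (\<lambda>M e. bind_pmf M (f e)) (g m) es)"
  by (induction es arbitrary: g) (simp_all add: bind_assoc_pmf)

text \<open>The Markov property: given the seed, the suffix acts on the current memory only, so a
  run splits into an encoder and a decoder.\<close>

lemma mem_after_append:
  "mem_after A r (es @ bs) = bind_pmf (mem_after A r es)
     (\<lambda>m. foldl (\<lambda>M e. bind_pmf M (process_edge A r e)) (return_pmf m) bs)"
  using foldl_bind_pmf[of "process_edge A r" "mem_after A r es" return_pmf bs]
  by (simp add: mem_after_def bind_return_pmf')

text \<open>The reduction from the INDEX problem. The set \<open>x\<close> is stored as a bipartite graph between
  \<open>{..<l}\<close> and \<open>{l..<2 * l}\<close>. The query for the pair \<open>(i, j)\<close> adds a pendant vertex \<open>2 * l + 2\<close> at \<open>i\<close>, and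
  joins the hub \<open>2 * l\<close>, which has the private neighbour \<open>2 * l + 1\<close>, to everything except
  \<open>l + j\<close>, \<open>2 * l + 2\<close> and \<open>k - 2\<close> vertices that remain isolated.
  Up to the choice of a pendant vertex instead of its neighbour, this forces all \<open>k\<close> dominators,
  and \<open>l + j\<close> can only be dominated by \<open>i\<close>.\<close>

definition index_edges :: "nat \<Rightarrow> (nat \<times> nat) set \<Rightarrow> nat set set" where
  "index_edges l x = (\<lambda>(i, j). {i, l + j}) ` x"

definition isolated_vertices :: "nat \<Rightarrow> nat \<Rightarrow> nat set" where
  "isolated_vertices k l = {2 * l + 3..<2 * l + k + 1}"

definition query_edges :: "nat \<Rightarrow> nat \<Rightarrow> nat \<Rightarrow> nat \<times> nat \<Rightarrow> nat set set" where
  "query_edges k n l p = insert {fst p, 2 * l + 2}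
     ((\<lambda>v. {2 * l, v}) ` ({..<n} - isolated_vertices k l - {2 * l, 2 * l + 2, l + snd p}))"

lemma has_k_dominating_set_reduction:
  assumes k: "k \<ge> 2" and n: "2 * l + k + 1 \<le> n"
    and x: "x \<subseteq> {..<l} \<times> {..<l}" and ij: "i < l" "j < l"
  shows "has_k_dominating_set k {..<n} (index_edges l x \<union> query_edges k n l (i, j))
           \<longleftrightarrow> (i, j) \<in> x"
    (is "has_k_dominating_set k ?V ?E \<longleftrightarrow> _")
proof
  define T where "T = isolated_vertices k l"
  have T: "finite T" "card T = k - 2"
    by (auto simp: T_def isolated_vertices_def)
  have edge_iff: "{u, v} \<in> ?E \<longleftrightarrow>
      (\<exists>a b. (a, b) \<in> x \<and> (u = a \<and> v = l + b \<or> v = a \<and> u = l + b)) \<or>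
      (u = i \<and> v = 2 * l + 2 \<or> v = i \<and> u = 2 * l + 2) \<or>
      (u = 2 * l \<and> v \<in> ?V - T - {2 * l, 2 * l + 2, l + j} \<or>
       v = 2 * l \<and> u \<in> ?V - T - {2 * l, 2 * l + 2, l + j})" for u v
  proof -
    have "{u, v} \<in> index_edges l x \<longleftrightarrow> (\<exists>a b. (a, b) \<in> x \<and> {u, v} = {a, l + b})"
      unfolding index_edges_def image_iff by auto
    moreover have "{u, v} \<in> query_edges k n l (i, j) \<longleftrightarrow> {u, v} = {i, 2 * l + 2} \<or>
        (\<exists>w\<in>?V - T - {2 * l, 2 * l + 2, l + j}. {u, v} = {2 * l, w})"
      unfolding query_edges_def T_def[symmetric] image_iff by auto
    ultimately show ?thesis
      unfolding Un_iff doubleton_eq_iff by blast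
  qed
  {
    assume "(i, j) \<in> x"
    \<comment> \<open>\<open>i\<close> covers the pendant vertex and, through the stored edge,
      \<open>l + j\<close>; the hub covers all other vertices outside \<open>T\<close>.\<close>
    define S where "S = insert i (insert (2 * l) T)"
    have "card S \<le> Suc (Suc (card T))"
      unfolding S_def using T by (simp add: card_insert_if)
    then have "card S \<le> k"
      using T k by simp
    moreover have "dominating_set ?V ?E S"
      unfolding dominating_set_def
    proof (intro conjI ballI)
      show "S \<subseteq> ?V"
        using ij n k by (auto simp: S_def T_def isolated_vertices_def)
      fix v assume v: "v \<in> ?V - S"
      show "\<exists>u\<in>S. {u, v} \<in> ?E"
      proof (cases "v = 2 * l + 2 \<or> v = l + j")
        case True
        then have "{i, v} \<in> ?E"
          unfolding edge_iff using \<open>(i, j) \<in> x\<close> by blast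
        then show ?thesis
          by (auto simp: S_def)
      next
        case False
        then have "{2 * l, v} \<in> ?E"
          unfolding edge_iff using v by (auto simp: S_def)
        then show ?thesis
          by (auto simp: S_def)
      qed
    qed
    moreover have "finite S"
      using T by (simp add: S_def)
    ultimately show "has_k_dominating_set k ?V ?E"
      unfolding has_k_dominating_set_def by blast
  }
  {
    assume "has_k_dominating_set k ?V ?E"
    then obtain S where S: "finite S" "card S \<le> k" "dominating_set ?V ?E S"
      unfolding has_k_dominating_set_def by blast
    have dom: "v \<in> S \<or> (\<exists>u\<in>S. {u, v} \<in> ?E)" if "v < n" for v
      using S(3) that by (auto simp: dominating_set_def)
    have T_S: "T \<subseteq> S"
    proof
      fix t assume t: "t \<in> T"
      then have "t \<ge> 2 * l + 3" "t < n"
        using n by (auto simp: T_def isolated_vertices_def)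
      moreover have "{u, t} \<notin> ?E" for u
        unfolding edge_iff using t x ij \<open>t \<ge> 2 * l + 3\<close> by auto
      ultimately show "t \<in> S"
        using dom by blast
    qed
    have "\<exists>h\<in>S. h = 2 * l \<or> h = 2 * l + 1"
    proof -
      have "u = 2 * l" if "{u, 2 * l + 1} \<in> ?E" for u
        using that x ij unfolding edge_iff by auto
      then show ?thesis
        using dom[of "2 * l + 1"] n k by auto
    qed
    then obtain h where h: "h \<in> S" "h = 2 * l \<or> h = 2 * l + 1"
      by blast
    have "\<exists>q\<in>S. q = i \<or> q = 2 * l + 2"
    proof -
      have "u = i" if "{u, 2 * l + 2} \<in> ?E" for u
        using that x ij unfolding edge_iff by auto
      then show ?thesis
        using dom[of "2 * l + 2"] n k by auto
    qed
    then obtain q where q: "q \<in> S" "q = i \<or> q = 2 * l + 2"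
      by blast
    \<comment> \<open>The forced vertices are distinct and already number \<open>k\<close>, so the
      budget is exhausted.\<close>
    have "h \<notin> T" "q \<notin> insert h T"
      using h q ij by (auto simp: T_def isolated_vertices_def)
    then have "card (insert q (insert h T)) = k"
      using T k by simp
    then have S_eq: "S = insert q (insert h T)"
      using S T_S h q by (intro card_seteq[symmetric]) auto
    have "l + j \<notin> S"
      using S_eq h q ij by (auto simp: T_def isolated_vertices_def)
    then obtain u where u: "u \<in> S" "{u, l + j} \<in> ?E"
      using dom[of "l + j"] ij n by auto
    \<comment> \<open>Neither choice of \<open>h\<close>, nor \<open>2 * l + 2\<close>, nor an
      isolated vertex is adjacent to \<open>l + j\<close>. Only \<open>u = i\<close> remains, and
      its edge must come from \<open>x\<close>.\<close>
    have "u = h \<or> u = q \<or> u \<ge> 2 * l + 3"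
      using u S_eq by (auto simp: T_def isolated_vertices_def)
    then show "(i, j) \<in> x"
      using u(2) h q x ij unfolding edge_iff by auto
  }
qed

section \<open>The space bound\<close>

lemma solves_dominating_set_space:
  assumes k: "k \<ge> 2" and n: "2 * l + k + 1 \<le> n"
    and solves: "solves_dominating_set k n A" and space: "uses_space n A s"
  shows "(real l)\<^sup>2 / 36 \<le> real s + 1"
proof -
  define I where "I = {..<l} \<times> {..<l}"
  define M where "M = {m :: bool list. length m \<le> s}"
  have I: "finite I" "card I = l\<^sup>2"
    by (auto simp: I_def power2_eq_square)
  have M: "finite M" "M \<noteq> {}"
    using finite_lists_length_le[of "UNIV :: bool set" s] by (auto simp: M_def intro: exI[of _ "[]"])
  have fin_index: "finite (index_edges l x)" if "x \<subseteq> I" for x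
    using that I finite_subset by (auto simp: index_edges_def)
  have fin_query: "finite (query_edges k n l p)" for p
    by (auto simp: query_edges_def)
  obtain es where es: "\<And>x. x \<subseteq> I \<Longrightarrow> set (es x) = index_edges l x \<and> distinct (es x)"
    using finite_distinct_list[OF fin_index] by metis
  obtain bs where bs: "\<And>p. set (bs p) = query_edges k n l p \<and> distinct (bs p)"
    using finite_distinct_list[OF fin_query] by metis
  have stream: "edge_stream n (es x @ bs p)" if x: "x \<subseteq> I" and p: "p \<in> I" for x p
  proof -
    \<comment> \<open>Stored edges stay below \<open>2 * l\<close> and query edges do not, so no
      edge arrives twice.\<close>
    have "e \<subseteq> {..<n} \<and> card e = 2 \<and> e \<subseteq> {..<2 * l}" if "e \<in> index_edges l x" for e
      using that x n by (auto simp: index_edges_def I_def)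
    moreover have "e \<subseteq> {..<n} \<and> card e = 2 \<and> \<not> e \<subseteq> {..<2 * l}" if "e \<in> query_edges k n l p" for e
      using that p n k by (auto simp: query_edges_def I_def)
    ultimately show ?thesis
      unfolding edge_stream_def using es[OF x] bs[of p] by auto blast
  qed
  define dec where "dec r m p = bind_pmf
      (foldl (\<lambda>M e. bind_pmf M (process_edge A r e)) (return_pmf m) (bs p)) (final_answer A r)"
    for r m p
  have "card I / 36 \<le> ln (card M)"
  proof (rule index_lower_bound[OF I(1) M, where seed = "seed_dist A"
        and enc = "\<lambda>r x. mem_after A r (es x)" and dec = dec])
    fix r x assume r: "r \<in> set_pmf (seed_dist A)" and x: "x \<subseteq> I"
    have "edge_stream n (es x)"
      using x n es[OF x] by (auto simp: edge_stream_def index_edges_def I_def)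
    then show "set_pmf (mem_after A r (es x)) \<subseteq> M"
      using space r by (auto simp: uses_space_def M_def)
  next
    fix x p assume x: "x \<subseteq> I" and p: "p \<in> I"
    have "2 / 3 \<le> pmf (answer_on A (es x @ bs p))
        (has_k_dominating_set k {..<n} (set (es x @ bs p)))"
      using solves stream[OF x p] unfolding solves_dominating_set_def by blast
    moreover have "has_k_dominating_set k {..<n} (set (es x @ bs p)) = (p \<in> x)"
      using has_k_dominating_set_reduction[OF k n, of x "fst p" "snd p"] x p es[OF x] bs[of p]
      by (auto simp: I_def)
    moreover have "answer_on A (es x @ bs p)
        = bind_pmf (seed_dist A) (\<lambda>r. bind_pmf (mem_after A r (es x)) (\<lambda>m. dec r m p))"
      by (simp add: answer_on_def mem_after_append bind_assoc_pmf dec_def)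
    ultimately show "2 / 3 \<le> pmf (bind_pmf (seed_dist A)
        (\<lambda>r. bind_pmf (mem_after A r (es x)) (\<lambda>m. dec r m p))) (p \<in> x)"
      by (simp only:)
  qed
  also have "ln (card M) \<le> ln (2 ^ (s + 1))"
  proof -
    have "0 < card M"
      using M by (simp add: card_gt_0_iff)
    moreover have "real (card M) \<le> 2 ^ (s + 1)"
      using of_nat_mono[OF card_bool_lists_length_le[of s], where 'a = real]
      unfolding M_def by simp
    ultimately show ?thesis
      by (subst ln_le_cancel_iff) auto
  qed
  also have "\<dots> = (real s + 1) * ln 2"
    by (subst ln_realpow) auto
  also have "\<dots> \<le> (real s + 1) * 1"
    using ln_le_minus_one[of "2 :: real"] by (intro mult_left_mono) auto
  finally show ?thesis
    by (simp add: I)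
qed

theorem theorem28:
  fixes k :: nat and A :: "nat \<Rightarrow> 'r streaming_alg" and s :: "nat \<Rightarrow> nat"
  assumes "k \<ge> 3"
    and "\<And>n. solves_dominating_set k n (A n)"
    and "\<And>n. uses_space n (A n) (s n)"
  shows "(\<lambda>n. real (s n)) \<in> \<Omega>(\<lambda>n. real n ^ 2)"
proof -
  \<comment> \<open>Here \<open>n \<le> 4 * l\<close> gives n^2/576 \<le> s + 1. Half of the left
    side absorbs the 1 once n^2 \<ge> 1152, and 34^2 = 1156.\<close>
  have bound: "(1 / 1152) * norm (real n ^ 2) \<le> norm (real (s n))" if n: "n \<ge> 2 * k + 34" for n
  proof -
    define l where "l = (n - k - 1) div 2"
    have "2 * l + k + 1 \<le> n"
      using n by (simp add: l_def)
    then have "(real l)\<^sup>2 / 36 \<le> real (s n) + 1"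
      using assms by (intro solves_dominating_set_space[of k l n "A n"]) auto
    moreover have "(real n / 4)\<^sup>2 \<le> (real l)\<^sup>2"
    proof (rule power_mono)
      have "n \<le> 4 * l"
        using n unfolding l_def by linarith
      then show "real n / 4 \<le> real l"
        by linarith
    qed simp
    moreover have "(34 :: real)\<^sup>2 \<le> (real n)\<^sup>2"
      using n by (intro power_mono) auto
    ultimately show ?thesis
      by (simp add: power_divide)
  qed
  show ?thesis
    by (rule landau_omega.bigI[of "1 / 1152"])
      (use bound in \<open>auto simp: eventually_at_top_linorder\<close>)
qed

end
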